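(* Let $(X,d)$ be a complete metric space and let $n\ge 1$ be an integer. Then the function $\mathcal{D}:\mathcal{S}_X^n\times\mathcal{S}_X^n\to\mathbb{R}$ given, for $\mathbb{S}=\{X;f_1,\dots,f_n\}$ and $\mathbb{T}=\{X;g_1,\dots,g_n\}$ in $\mathcal{S}_X^n$, by $$\mathcal{D}(\mathbb{S},\mathbb{T})=\min_{\sigma\in S_n}\sum_{i=1}^{n}\bar{d}_\infty(f_i,g_{\sigma(i)})$$ is a metric on $\mathcal{S}_X^n$; that is, $(\mathcal{S}_X^n,\mathcal{D})$ is a metric space.
   Context: A contraction on $X$ is a map $f:X\to X$ for which there is a constant $c\in[0,1)$ with $d(f(x),f(y))\le c\,d(x,y)$ for all $x,y\in X$. An $n$-iterated function system on $X$, written $\{X;f_1,\dots,f_n\}$, consists of $n$ contractions $f_1,\dots,f_n$ on $X$; $\mathcal{S}_X^n$ denotes the collection of all of them. Two $n$-iterated function systems $\{X;f_1,\dots,f_n\}$ and $\{X;g_1,\dots,g_n\}$ are regarded as equal if there is a permutation $\sigma$ of $\{1,\dots,n\}$ with $f_i=g_{\sigma(i)}$ for all $i$ (so elements of $\mathcal{S}_X^n$ are unordered lists of $n$ contractions, i.e. multisets). $S_n$ is the group of permutations of $\{1,\dots,n\}$. For functions $f,g:X\to X$, $$\bar{d}_\infty(f,g)=\sup_{x\in X}\frac{d(f(x),g(x))}{1+d(f(x),g(x))},$$ which is a metric on the set of all functions from $X$ to itself. *)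

theory Defs
  imports "HOL-Analysis.Analysis" "HOL-Combinatorics.Permutations" "HOL-Library.Multiset"
begin

definition is_contraction :: "('a::metric_space \<Rightarrow> 'a) \<Rightarrow> bool" where
  "is_contraction f \<longleftrightarrow>
     (\<exists>c::real. 0 \<le> c \<and> c < 1 \<and> (\<forall>x y. dist (f x) (f y) \<le> c * dist x y))"

text \<open>An \<open>n\<close>-iterated function system is an unordered list of \<open>n\<close> contractions, repetitions
  allowed: \<open>mset fs = mset gs\<close> iff \<open>fs\<close> and \<open>gs\<close> differ by a permutation of the indices.\<close>

definition ifs_space :: "nat \<Rightarrow> ('a::metric_space \<Rightarrow> 'a) multiset set" where
  "ifs_space n = {S. size S = n \<and> (\<forall>f \<in># S. is_contraction f)}"

text \<open>The values lie in \<open>{0..<1}\<close>, so the real supremum is a genuine one.\<close>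

definition dbar_inf :: "('a::metric_space \<Rightarrow> 'a) \<Rightarrow> ('a \<Rightarrow> 'a) \<Rightarrow> real" where
  "dbar_inf f g = (SUP x. dist (f x) (g x) / (1 + dist (f x) (g x)))"

text \<open>The minimum, for given enumerations; the indices run over \<open>0, \<dots>, n - 1\<close>.\<close>

definition perm_min_dist ::
    "nat \<Rightarrow> ('a::metric_space \<Rightarrow> 'a) list \<Rightarrow> ('a \<Rightarrow> 'a) list \<Rightarrow> real" where
  "perm_min_dist n fs gs =
     Min ((\<lambda>\<sigma>. \<Sum>i<n. dbar_inf (fs ! i) (gs ! \<sigma> i)) ` {\<sigma>. \<sigma> permutes {..<n}})"

text \<open>The function on unordered systems is obtained from arbitrarily chosen enumerations; independence
  of that choice is not built in and has to be proved. The value \<open>0\<close> off \<open>ifs_space n\<close> is a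
  totalization: the locale \<open>Metric_space\<close> demands nonnegativity and symmetry on the whole type.\<close>

definition ifs_dist ::
    "nat \<Rightarrow> ('a::metric_space \<Rightarrow> 'a) multiset \<Rightarrow> ('a \<Rightarrow> 'a) multiset \<Rightarrow> real" where
  "ifs_dist n S T =
     (if S \<in> ifs_space n \<and> T \<in> ifs_space n
      then perm_min_dist n (SOME fs. mset fs = S) (SOME gs. mset gs = T)
      else 0)"

end

theory Submission
  imports Defs
begin

text \<open>The map \<open>t \<mapsto> t / (1 + t)\<close> is increasing and subadditive on \<open>[0,
  \<infinity>)\<close>, bounded by \<open>1\<close> and vanishes only at \<open>0\<close>; taking
  suprema, \<open>dbar_inf\<close> inherits the metric axioms on the set of all self-maps of the space
  (the pointwise estimate is \<open>bounded_transform_triangle\<close>). A minimum over index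
  permutations is then a metric on unordered \<open>n\<close>-tuples by reindexing: relabelling the
  entries of either list only replaces \<open>\<sigma>\<close> by a composite permutation (so the value
  depends on the multisets alone, \<open>perm_min_dist_cong_mset\<close>),
  \<open>\<sigma>\<inverse>\<close> gives symmetry, composing two optimal permutations gives the triangle
  inequality (\<open>perm_min_dist_triangle\<close>), and a vanishing sum of nonnegative terms says that
  the optimal permutation carries one list to the other (\<open>perm_min_dist_zero_iff\<close>).\<close>

lemma bounded_transform_triangle:
  fixes a b c :: real
  assumes "0 \<le> a" "0 \<le> b" "0 \<le> c" "a \<le> b + c"
  shows "a / (1 + a) \<le> b / (1 + b) + c / (1 + c)"
proof -
  have "a / (1 + a) \<le> (b + c) / (1 + (b + c))"
    using assms by (simp add: field_simps)
  also have "\<dots> = b / (1 + (b + c)) + c / (1 + (b + c))"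
    by (simp add: add_divide_distrib)
  also have "\<dots> \<le> b / (1 + b) + c / (1 + c)"
    using assms by (intro add_mono divide_left_mono) (auto intro!: mult_pos_pos)
  finally show ?thesis .
qed

lemma dbar_inf_upper: "dist (f x) (g x) / (1 + dist (f x) (g x)) \<le> dbar_inf f g"
  unfolding dbar_inf_def
proof (rule cSUP_upper)
  show "bdd_above (range (\<lambda>x. dist (f x) (g x) / (1 + dist (f x) (g x))))"
  proof (rule bdd_aboveI2)
    fix x
    show "dist (f x) (g x) / (1 + dist (f x) (g x)) \<le> 1"
      by (simp add: divide_le_eq_1 add_pos_nonneg)
  qed
qed simp

lemma dbar_inf_least:
  assumes "\<And>x. dist (f x) (g x) / (1 + dist (f x) (g x)) \<le> B"
  shows "dbar_inf f g \<le> B"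
  unfolding dbar_inf_def using assms by (intro cSUP_least) auto

lemma dbar_inf_nonneg: "0 \<le> dbar_inf f g"
  by (rule order_trans[OF _ dbar_inf_upper[of f undefined g]]) simp

lemma dbar_inf_commute: "dbar_inf f g = dbar_inf g f"
  by (simp add: dbar_inf_def dist_commute)

lemma dbar_inf_refl: "dbar_inf f f = 0"
  by (simp add: dbar_inf_def)

lemma dbar_inf_zero_imp_eq:
  assumes "dbar_inf f g = 0"
  shows "f = g"
proof
  fix x
  have "dist (f x) (g x) / (1 + dist (f x) (g x)) \<le> 0"
    using dbar_inf_upper[of f x g] assms by simp
  moreover have "0 < 1 + dist (f x) (g x)"
    by (simp add: add_pos_nonneg)
  ultimately show "f x = g x"
    by (simp add: divide_le_0_iff)
qed

lemma dbar_inf_triangle: "dbar_inf f h \<le> dbar_inf f g + dbar_inf g h"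
proof (rule dbar_inf_least)
  fix x
  have "dist (f x) (h x) / (1 + dist (f x) (h x))
      \<le> dist (f x) (g x) / (1 + dist (f x) (g x)) + dist (g x) (h x) / (1 + dist (g x) (h x))"
    by (intro bounded_transform_triangle dist_triangle) simp_all
  also have "\<dots> \<le> dbar_inf f g + dbar_inf g h"
    by (intro add_mono dbar_inf_upper)
  finally show "dist (f x) (h x) / (1 + dist (f x) (h x)) \<le> dbar_inf f g + dbar_inf g h" .
qed

lemma perm_min_dist_le:
  assumes "\<sigma> permutes {..<n}"
  shows "perm_min_dist n fs gs \<le> (\<Sum>i<n. dbar_inf (fs ! i) (gs ! \<sigma> i))"
  unfolding perm_min_dist_def using assms by (intro Min_le) (auto simp: finite_permutations)

lemma perm_min_dist_attained:
  obtains \<sigma> where "\<sigma> permutes {..<n}"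
    "perm_min_dist n fs gs = (\<Sum>i<n. dbar_inf (fs ! i) (gs ! \<sigma> i))"
proof -
  have "perm_min_dist n fs gs
      \<in> (\<lambda>\<sigma>. \<Sum>i<n. dbar_inf (fs ! i) (gs ! \<sigma> i)) ` {\<sigma>. \<sigma> permutes {..<n}}"
    unfolding perm_min_dist_def
    using permutes_id[of "{..<n}"] by (intro Min_in) (auto simp: finite_permutations simp del: permutes_id)
  then show ?thesis
    using that by blast
qed

lemma perm_min_dist_nonneg: "0 \<le> perm_min_dist n fs gs"
  by (rule perm_min_dist_attained[of n fs gs]) (simp add: sum_nonneg dbar_inf_nonneg)

text \<open>One inequality suffices, since the hypotheses are symmetric in the two pairs of lists.\<close>

lemma perm_min_dist_le_relabelled:
  assumes mset: "mset fs = mset fs'" "mset gs = mset gs'"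
    and len: "length fs = n" "length gs = n"
  shows "perm_min_dist n fs gs \<le> perm_min_dist n fs' gs'"
proof -
  obtain p where p: "p permutes {..<n}" "permute_list p fs = fs'"
    using mset_eq_permutation[of fs' fs] mset len by metis
  obtain q where q: "q permutes {..<n}" "permute_list q gs = gs'"
    using mset_eq_permutation[of gs' gs] mset len by metis
  obtain \<sigma> where \<sigma>: "\<sigma> permutes {..<n}"
    and min: "perm_min_dist n fs' gs' = (\<Sum>i<n. dbar_inf (fs' ! i) (gs' ! \<sigma> i))"
    by (rule perm_min_dist_attained)
  \<comment> \<open>\<open>\<tau>\<close> pairs the original position \<open>p i\<close> with \<open>q (\<sigma> i)\<close>, that is, the same functions that \<open>\<sigma>\<close>
    pairs in the relabelled lists.\<close>
  define \<tau> where "\<tau> = q \<circ> \<sigma> \<circ> inv p"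
  have "\<tau> permutes {..<n}"
    unfolding \<tau>_def using p q \<sigma> by (intro permutes_compose permutes_inv)
  then have "perm_min_dist n fs gs \<le> (\<Sum>j<n. dbar_inf (fs ! j) (gs ! \<tau> j))"
    by (rule perm_min_dist_le)
  also have "\<dots> = (\<Sum>i<n. dbar_inf (fs ! p i) (gs ! \<tau> (p i)))"
    using sum.permute[OF p(1)] by (simp add: comp_def)
  also have "\<dots> = (\<Sum>i<n. dbar_inf (fs' ! i) (gs' ! \<sigma> i))"
  proof (rule sum.cong)
    fix i assume i: "i \<in> {..<n}"
    have "\<sigma> i < n"
      using permutes_in_image[OF \<sigma>] i by auto
    then show "dbar_inf (fs ! p i) (gs ! \<tau> (p i)) = dbar_inf (fs' ! i) (gs' ! \<sigma> i)"
      using i p q len by (auto simp: \<tau>_def permutes_inverses permute_list_nth)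
  qed simp
  finally show ?thesis
    using min by simp
qed

lemma perm_min_dist_cong_mset:
  assumes "mset fs = mset fs'" "mset gs = mset gs'" "length fs = n" "length gs = n"
  shows "perm_min_dist n fs gs = perm_min_dist n fs' gs'"
proof (rule antisym)
  have "length fs' = n" "length gs' = n"
    using assms mset_eq_length by metis+
  then show "perm_min_dist n fs' gs' \<le> perm_min_dist n fs gs"
    using assms by (intro perm_min_dist_le_relabelled) simp_all
qed (use assms in \<open>intro perm_min_dist_le_relabelled\<close>)

lemma perm_min_dist_swap_le: "perm_min_dist n fs gs \<le> perm_min_dist n gs fs"
proof -
  obtain \<sigma> where \<sigma>: "\<sigma> permutes {..<n}"
    and min: "perm_min_dist n gs fs = (\<Sum>i<n. dbar_inf (gs ! i) (fs ! \<sigma> i))"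
    by (rule perm_min_dist_attained)
  have "perm_min_dist n fs gs \<le> (\<Sum>j<n. dbar_inf (fs ! j) (gs ! inv \<sigma> j))"
    by (intro perm_min_dist_le permutes_inv \<sigma>)
  also have "\<dots> = (\<Sum>i<n. dbar_inf (fs ! \<sigma> i) (gs ! i))"
    using sum.permute[OF \<sigma>, of "\<lambda>j. dbar_inf (fs ! j) (gs ! inv \<sigma> j)"]
    by (simp add: comp_def permutes_inverses[OF \<sigma>])
  finally show ?thesis
    by (simp add: min dbar_inf_commute)
qed

lemma perm_min_dist_commute: "perm_min_dist n fs gs = perm_min_dist n gs fs"
  by (intro antisym perm_min_dist_swap_le)

lemma perm_min_dist_triangle:
  "perm_min_dist n fs hs \<le> perm_min_dist n fs gs + perm_min_dist n gs hs"
proof -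
  obtain \<sigma> where \<sigma>: "\<sigma> permutes {..<n}"
    and min_fg: "perm_min_dist n fs gs = (\<Sum>i<n. dbar_inf (fs ! i) (gs ! \<sigma> i))"
    by (rule perm_min_dist_attained)
  obtain \<tau> where \<tau>: "\<tau> permutes {..<n}"
    and min_gh: "perm_min_dist n gs hs = (\<Sum>i<n. dbar_inf (gs ! i) (hs ! \<tau> i))"
    by (rule perm_min_dist_attained)
  have "perm_min_dist n fs hs \<le> (\<Sum>i<n. dbar_inf (fs ! i) (hs ! (\<tau> \<circ> \<sigma>) i))"
    by (intro perm_min_dist_le permutes_compose \<sigma> \<tau>)
  also have "\<dots> \<le> (\<Sum>i<n. dbar_inf (fs ! i) (gs ! \<sigma> i) + dbar_inf (gs ! \<sigma> i) (hs ! \<tau> (\<sigma> i)))"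
    by (intro sum_mono) (simp add: dbar_inf_triangle)
  also have "\<dots> = perm_min_dist n fs gs + (\<Sum>i<n. dbar_inf (gs ! \<sigma> i) (hs ! \<tau> (\<sigma> i)))"
    by (simp add: sum.distrib min_fg)
  also have "(\<Sum>i<n. dbar_inf (gs ! \<sigma> i) (hs ! \<tau> (\<sigma> i))) = perm_min_dist n gs hs"
    using sum.permute[OF \<sigma>, of "\<lambda>i. dbar_inf (gs ! i) (hs ! \<tau> i)"]
    by (simp add: comp_def min_gh)
  finally show ?thesis .
qed

lemma perm_min_dist_refl: "perm_min_dist n fs fs = 0"
  using perm_min_dist_le[OF permutes_id, of n fs fs] perm_min_dist_nonneg[of n fs fs]
  by (simp add: dbar_inf_refl)

lemma perm_min_dist_zero_iff:
  assumes "length fs = n" "length gs = n"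
  shows "perm_min_dist n fs gs = 0 \<longleftrightarrow> mset fs = mset gs"
proof
  assume zero: "perm_min_dist n fs gs = 0"
  obtain \<sigma> where \<sigma>: "\<sigma> permutes {..<n}"
    and "perm_min_dist n fs gs = (\<Sum>i<n. dbar_inf (fs ! i) (gs ! \<sigma> i))"
    by (rule perm_min_dist_attained)
  then have "\<forall>i<n. dbar_inf (fs ! i) (gs ! \<sigma> i) = 0"
    using zero by (simp add: sum_nonneg_eq_0_iff dbar_inf_nonneg)
  then have "\<forall>i<n. fs ! i = gs ! \<sigma> i"
    by (blast intro: dbar_inf_zero_imp_eq)
  then have "fs = permute_list \<sigma> gs"
    using assms \<sigma> by (intro nth_equalityI) (auto simp: permute_list_nth)
  then show "mset fs = mset gs"
    using assms \<sigma> by simp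
next
  assume "mset fs = mset gs"
  then have "perm_min_dist n fs gs = perm_min_dist n gs gs"
    using assms by (intro perm_min_dist_cong_mset) simp_all
  then show "perm_min_dist n fs gs = 0"
    by (simp add: perm_min_dist_refl)
qed

lemma length_of_ifs: "mset fs \<in> ifs_space n \<Longrightarrow> length fs = n"
  by (simp add: ifs_space_def)

text \<open>The value of \<open>ifs_dist\<close> does not depend on the enumerations chosen in its definition.\<close>

lemma ifs_dist_mset:
  assumes "mset fs \<in> ifs_space n" "mset gs \<in> ifs_space n"
  shows "ifs_dist n (mset fs) (mset gs) = perm_min_dist n fs gs"
proof -
  have fs: "mset (SOME fs'. mset fs' = mset fs) = mset fs"
    and gs: "mset (SOME gs'. mset gs' = mset gs) = mset gs"
    by (rule someI, rule refl)+
  have "perm_min_dist n fs gs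
      = perm_min_dist n (SOME fs'. mset fs' = mset fs) (SOME gs'. mset gs' = mset gs)"
    using assms by (intro perm_min_dist_cong_mset fs[symmetric] gs[symmetric] length_of_ifs)
  then show ?thesis
    using assms by (simp add: ifs_dist_def)
qed

theorem mainTheorem1:
  fixes n :: nat
  assumes "n \<ge> 1"
  shows "(\<forall>fs gs :: ('a::complete_space \<Rightarrow> 'a) list.
            mset fs \<in> ifs_space n \<longrightarrow> mset gs \<in> ifs_space n \<longrightarrow>
            ifs_dist n (mset fs) (mset gs) = perm_min_dist n fs gs)
       \<and> Metric_space (ifs_space n :: ('a \<Rightarrow> 'a) multiset set) (ifs_dist n)"
proof (intro conjI allI impI)
  show "Metric_space (ifs_space n :: ('a \<Rightarrow> 'a) multiset set) (ifs_dist n)"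
  proof
    fix S T :: "('a \<Rightarrow> 'a) multiset"
    show "0 \<le> ifs_dist n S T"
      by (simp add: ifs_dist_def perm_min_dist_nonneg)
    show "ifs_dist n S T = ifs_dist n T S"
      by (simp add: ifs_dist_def perm_min_dist_commute)
  next
    fix S T :: "('a \<Rightarrow> 'a) multiset"
    assume ST: "S \<in> ifs_space n" "T \<in> ifs_space n"
    obtain fs gs where "S = mset fs" "T = mset gs"
      by (metis ex_mset)
    then show "ifs_dist n S T = 0 \<longleftrightarrow> S = T"
      using ST by (simp add: ifs_dist_mset perm_min_dist_zero_iff length_of_ifs)
  next
    fix S T U :: "('a \<Rightarrow> 'a) multiset"
    assume "S \<in> ifs_space n" "T \<in> ifs_space n" "U \<in> ifs_space n"
    then show "ifs_dist n S U \<le> ifs_dist n S T + ifs_dist n T U"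
      by (simp add: ifs_dist_def perm_min_dist_triangle)
  qed
qed (rule ifs_dist_mset)

end
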